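(* Let $G$ be a graph with vertex set $V$ and let $\emptyset\neq D\subseteq V$. The neighborhood function $N: u\mapsto N_G(u)$ is an interference of $D$ (with respect to the complete graph on $V$) if and only if $G$ is point-determining and has no isolated vertices and, for every $u\in V\setminus D$, (a) $d(u,D)\le 2$, and (b) if $N^2(u)\cap D=\emptyset$, then there exists $v\in D\cap N(u)$ such that $u,v$ are contained in a triangle of $G$; equivalently, not all members of $D\cap N(u)$ are isolated in the induced subgraph $\langle N(u)\rangle_G$.
   Context: All graphs are finite and simple. $N(u)=N_G(u)$ is the open neighborhood of $u$ in $G$. The function $N: V\to 2^V$ is an interference of $D$ with respect to the complete graph on $V$ if $N$ is injective, $N(u)\neq\emptyset$ for all $u\in V$, and for every $u\in V\setminus D$ there is $v\in D$ with $N(u)\cap N(v)\neq\emptyset$. $G$ is point-determining if $N$ is injective (distinct vertices have distinct open neighborhoods). $d(u,v)$ is the graph distance in $G$ ($\infty$ if there is no path), $d(u,D)=\min_{v\in D}d(u,v)$, $N^2(u)=\{w\in V: d(u,w)=2\}$, and $\langle Y\rangle_G$ is the subgraph of $G$ induced on $Y\subseteq V$. *)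

theory Defs
  imports "Graph_Theory.Graph_Theory"
begin

text \<open>
  A finite simple graph is a \<^locale>\<open>graph\<close>: a finite, symmetric, loop-free digraph
  without parallel arcs, each edge being represented by its two opposite arcs.
\<close>

definition nbhd :: "('a, 'b) pre_digraph \<Rightarrow> 'a \<Rightarrow> 'a set" where
  "nbhd G u = {w. u \<rightarrow>\<^bsub>G\<^esub> w}"

text \<open>
  Any two distinct vertices are adjacent in the complete graph on \<open>V\<close>, so \<open>v\<close> in the
  last clause is only required to lie in \<open>D\<close>.
\<close>

definition interference_complete :: "'a set \<Rightarrow> 'a set \<Rightarrow> ('a \<Rightarrow> 'c set) \<Rightarrow> bool" where
  "interference_complete V D f \<longleftrightarrow>
     inj_on f V \<and> (\<forall>u\<in>V. f u \<noteq> {}) \<and> (\<forall>u\<in>V - D. \<exists>v\<in>D. f u \<inter> f v \<noteq> {})"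

definition point_determining :: "('a, 'b) pre_digraph \<Rightarrow> bool" where
  "point_determining G \<longleftrightarrow> inj_on (nbhd G) (verts G)"

definition isolated_vertex :: "('a, 'b) pre_digraph \<Rightarrow> 'a \<Rightarrow> bool" where
  "isolated_vertex G v \<longleftrightarrow> v \<in> verts G \<and> nbhd G v = {}"

text \<open>With unit arc weights the library's shortest path cost is the graph distance; it is
  \<open>\<infinity>\<close> if there is no walk.\<close>

definition graph_dist :: "('a, 'b) pre_digraph \<Rightarrow> 'a \<Rightarrow> 'a \<Rightarrow> ereal" where
  "graph_dist G u v = wf_digraph.\<mu> G (\<lambda>_. 1) u v"

text \<open>Only meaningful for finite nonempty \<open>D\<close>.\<close>

definition graph_dist_set :: "('a, 'b) pre_digraph \<Rightarrow> 'a \<Rightarrow> 'a set \<Rightarrow> ereal" where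
  "graph_dist_set G u D = (MIN v\<in>D. graph_dist G u v)"

definition nbhd2 :: "('a, 'b) pre_digraph \<Rightarrow> 'a \<Rightarrow> 'a set" where
  "nbhd2 G u = {w \<in> verts G. graph_dist G u w = 2}"

definition in_common_triangle :: "('a, 'b) pre_digraph \<Rightarrow> 'a \<Rightarrow> 'a \<Rightarrow> bool" where
  "in_common_triangle G u v \<longleftrightarrow>
     (\<exists>T. subgraph T G \<and> K\<^bsub>3\<^esub> T \<and> u \<in> verts T \<and> v \<in> verts T)"

end

theory Submission
  imports Defs
begin

text \<open>
  Injectivity of \<^term>\<open>nbhd G\<close> is point-determination and nonemptiness of its values is the absence
  of isolated vertices, so only the last clause of an interference has content: each vertex
  \<open>u\<close> outside \<open>D\<close> must share a neighbour with some \<open>v\<close> in \<open>D\<close>. A vertex \<open>v \<noteq> u\<close> that shares a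
  neighbour \<open>w\<close> with \<open>u\<close> falls under one of two cases. If \<open>u\<close> and \<open>v\<close> are not adjacent, then
  \<open>u, w, v\<close> is a shortest walk and \<open>v\<close> is at distance two (lemma \<open>nbhd2_eq\<close>). If they are
  adjacent, then \<open>u, v, w\<close> span a triangle (lemma \<open>in_common_triangle_iff\<close>). Both cases can be
  reversed, so the sharing clause says exactly that \<open>D\<close> meets the second neighbourhood of \<open>u\<close> or
  contains a neighbour lying in a triangle with \<open>u\<close>, which is condition (b). Condition (a) then
  holds as well, since the vertex found in \<open>D\<close> is at distance one or two.

  The second form of (b) holds because a neighbour \<open>v\<close> of \<open>u\<close> is joined to another neighbour
  \<open>w\<close> of \<open>u\<close> precisely when \<open>u, v, w\<close> is a triangle.
\<close>

lemma (in sym_digraph) nbhd_commute: "w \<in> nbhd G v \<longleftrightarrow> v \<in> nbhd G w"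
  by (auto simp: nbhd_def intro: graph_symmetric)

lemma (in loopfree_digraph) not_in_own_nbhd: "u \<notin> nbhd G u"
  by (auto simp: nbhd_def dest: adj_not_same)

lemma (in wf_digraph) nbhd_subset_verts: "nbhd G u \<subseteq> verts G"
  by (auto simp: nbhd_def dest: adj_in_verts)


section \<open>Small distances\<close>

lemma (in wf_digraph) awalk_cost_unit: "awalk_cost (\<lambda>_. 1) p = length p"
  by (induction p) auto

text \<open>
  The distance is an infimum of extended reals, but only natural numbers occur as walk lengths.
  A strict bound by \<open>n + 1\<close> therefore already produces a walk of length at most \<open>n\<close>, without
  first showing that the infimum is attained.
\<close>

lemma (in wf_digraph) graph_dist_less_Suc_iff:
  "graph_dist G u v < ereal (real (Suc n)) \<longleftrightarrow> (\<exists>p. awalk u p v \<and> length p \<le> n)"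
  by (auto simp: graph_dist_def \<mu>_def INF_less_iff awalk_cost_unit simp del: of_nat_Suc)

lemma (in wf_digraph) graph_dist_le_iff:
  "graph_dist G u v \<le> ereal (real n) \<longleftrightarrow> (\<exists>p. awalk u p v \<and> length p \<le> n)"
proof
  assume "graph_dist G u v \<le> ereal (real n)"
  also have "\<dots> < ereal (real (Suc n))" by simp
  finally show "\<exists>p. awalk u p v \<and> length p \<le> n"
    by (simp only: graph_dist_less_Suc_iff)
next
  assume "\<exists>p. awalk u p v \<and> length p \<le> n"
  then obtain p where p: "awalk u p v" "length p \<le> n" by blast
  have "graph_dist G u v \<le> ereal (awalk_cost (\<lambda>_. 1) p)"
    unfolding graph_dist_def using p(1) by (rule min_cost_le_walk_cost)
  also have "\<dots> \<le> ereal (real n)" using p(2) by (simp add: awalk_cost_unit)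
  finally show "graph_dist G u v \<le> ereal (real n)" .
qed

lemma (in wf_digraph) graph_dist_le_0_iff:
  "graph_dist G u v \<le> ereal (real 0) \<longleftrightarrow> u \<in> verts G \<and> u = v"
  unfolding graph_dist_le_iff by (auto simp: awalk_Nil_iff)

lemma (in wf_digraph) graph_dist_le_Suc_iff:
  "graph_dist G u v \<le> ereal (real (Suc n)) \<longleftrightarrow>
     u \<in> verts G \<and> u = v \<or> (\<exists>x \<in> nbhd G u. graph_dist G x v \<le> ereal (real n))"
  (is "?dist \<longleftrightarrow> ?step")
proof
  assume ?dist
  then obtain p where p: "awalk u p v" "length p \<le> Suc n"
    unfolding graph_dist_le_iff by blast
  show ?step
  proof (cases p)
    case Nil
    then show ?thesis using p by (auto simp: awalk_Nil_iff)
  next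
    case (Cons e q)
    with p have "e \<in> arcs G" "tail G e = u" "awalk (head G e) q v" "length q \<le> n"
      by (auto simp: awalk_Cons_iff)
    moreover from this have "head G e \<in> nbhd G u"
      by (auto simp: nbhd_def arcs_ends_conv)
    ultimately show ?thesis unfolding graph_dist_le_iff by blast
  qed
next
  assume ?step
  then show ?dist
  proof
    assume "u \<in> verts G \<and> u = v"
    then have "awalk u [] v" by (auto simp: awalk_Nil_iff)
    then show ?dist unfolding graph_dist_le_iff by (intro exI[of _ "[]"]) simp
  next
    assume "\<exists>x \<in> nbhd G u. graph_dist G x v \<le> ereal (real n)"
    then obtain x p where x: "u \<rightarrow>\<^bsub>G\<^esub> x" and p: "awalk x p v" "length p \<le> n"
      unfolding graph_dist_le_iff nbhd_def by blast
    from x obtain e where "e \<in> arcs G" "tail G e = u" "head G e = x" by blast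
    with p have "awalk u (e # p) v" "length (e # p) \<le> Suc n"
      by (auto simp: awalk_Cons_iff)
    then show ?dist unfolding graph_dist_le_iff by blast
  qed
qed

lemma (in wf_digraph) graph_dist_le_1_iff:
  "graph_dist G u v \<le> ereal (real 1) \<longleftrightarrow> u \<in> verts G \<and> u = v \<or> v \<in> nbhd G u"
  using nbhd_subset_verts[of u] graph_dist_le_Suc_iff[of u v 0]
  by (auto simp only: graph_dist_le_0_iff One_nat_def)

text \<open>
  Distance exactly two means distance at most two but not at most one. The vertex \<open>u\<close> itself
  shares its neighbours with itself and has to be excluded by hand.
\<close>

lemma (in graph) nbhd2_eq:
  assumes "u \<in> verts G"
  shows "nbhd2 G u = {v. v \<noteq> u \<and> v \<notin> nbhd G u \<and> nbhd G u \<inter> nbhd G v \<noteq> {}}"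
proof -
  have le2: "graph_dist G u v \<le> 2 \<longleftrightarrow> v = u \<or> v \<in> nbhd G u \<or> nbhd G u \<inter> nbhd G v \<noteq> {}" for v
  proof -
    have "graph_dist G u v \<le> 2 \<longleftrightarrow> graph_dist G u v \<le> ereal (real (Suc 1))"
      by simp
    also have "\<dots> \<longleftrightarrow> v = u \<or> (\<exists>x \<in> nbhd G u. x \<in> verts G \<and> x = v \<or> v \<in> nbhd G x)"
      unfolding graph_dist_le_Suc_iff graph_dist_le_1_iff using assms by auto
    also have "\<dots> \<longleftrightarrow> v = u \<or> v \<in> nbhd G u \<or> nbhd G u \<inter> nbhd G v \<noteq> {}"
    proof -
      have "(\<exists>x \<in> nbhd G u. v \<in> nbhd G x) \<longleftrightarrow> (\<exists>x \<in> nbhd G u. x \<in> nbhd G v)"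
        by (rule bex_cong[OF refl nbhd_commute])
      then show ?thesis using nbhd_subset_verts[of u] by blast
    qed
    finally show ?thesis .
  qed
  have less2: "graph_dist G u v < 2 \<longleftrightarrow> v = u \<or> v \<in> nbhd G u" for v
  proof -
    have "graph_dist G u v < 2 \<longleftrightarrow> graph_dist G u v < ereal (real (Suc 1))"
      by simp
    also have "\<dots> \<longleftrightarrow> graph_dist G u v \<le> ereal (real 1)"
      by (simp only: graph_dist_less_Suc_iff graph_dist_le_iff)
    also have "\<dots> \<longleftrightarrow> v = u \<or> v \<in> nbhd G u"
      using assms unfolding graph_dist_le_1_iff by auto
    finally show ?thesis .
  qed
  have "graph_dist G u v = 2 \<longleftrightarrow> graph_dist G u v \<le> 2 \<and> \<not> graph_dist G u v < 2" for v
    by auto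
  moreover have "v \<in> verts G" if "nbhd G u \<inter> nbhd G v \<noteq> {}" for v
  proof -
    from that obtain w where "w \<in> nbhd G v" by blast
    then have "v \<in> nbhd G w" by (rule nbhd_commute[THEN iffD1])
    then show ?thesis using nbhd_subset_verts by blast
  qed
  ultimately show ?thesis unfolding nbhd2_def le2 less2 by blast
qed

lemma (in fin_digraph) graph_dist_set_le_iff:
  assumes "D \<noteq> {}" "D \<subseteq> verts G"
  shows "graph_dist_set G u D \<le> r \<longleftrightarrow> (\<exists>v \<in> D. graph_dist G u v \<le> r)"
  using assms finite_subset[OF assms(2) finite_verts]
  by (auto simp: graph_dist_set_def Min_le_iff)


section \<open>Triangles\<close>

text \<open>
  Three mutually adjacent vertices induce a \<^term>\<open>K\<^bsub>3\<^esub>\<close>; loop-freeness makes them distinct.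
  Conversely the third vertex of a triangle is a common neighbour of the other two.
\<close>

lemma (in graph) in_common_triangle_iff:
  assumes "u \<noteq> v"
  shows "in_common_triangle G u v \<longleftrightarrow> v \<in> nbhd G u \<and> nbhd G u \<inter> nbhd G v \<noteq> {}"
proof
  assume "in_common_triangle G u v"
  then obtain T where T: "subgraph T G" "K\<^bsub>3\<^esub> T" and uv: "u \<in> verts T" "v \<in> verts T"
    unfolding in_common_triangle_def by blast
  from T(2) have card: "card (verts T) = 3"
    and ends: "arcs_ends T = {(x, y). (x, y) \<in> verts T \<times> verts T \<and> x \<noteq> y}"
    unfolding complete_digraph_def by auto
  have "card {u, v} < card (verts T)" using assms card by simp
  then have "\<not> verts T \<subseteq> {u, v}"
    using card_mono[of "{u, v}" "verts T"] by fastforce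
  then obtain w where "w \<in> verts T" "w \<noteq> u" "w \<noteq> v" by blast
  then have "(u, v) \<in> arcs_ends T" "(u, w) \<in> arcs_ends T" "(v, w) \<in> arcs_ends T"
    using uv assms ends by auto
  then show "v \<in> nbhd G u \<and> nbhd G u \<inter> nbhd G v \<noteq> {}"
    using arcs_ends_mono[OF T(1)] by (auto simp: nbhd_def)
next
  assume "v \<in> nbhd G u \<and> nbhd G u \<inter> nbhd G v \<noteq> {}"
  then obtain w where uv: "u \<rightarrow>\<^bsub>G\<^esub> v" and uw: "u \<rightarrow>\<^bsub>G\<^esub> w" and vw: "v \<rightarrow>\<^bsub>G\<^esub> w"
    by (auto simp: nbhd_def)
  note adj = uv uw vw graph_symmetric[OF uv] graph_symmetric[OF uw] graph_symmetric[OF vw]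
  have distinct: "u \<noteq> v" "u \<noteq> w" "v \<noteq> w" using uv uw vw adj_not_same by auto
  define T where "T = G \<restriction> {u, v, w}"
  have "{u, v, w} \<subseteq> verts G" using adj by (auto dest: adj_in_verts)
  then have ind: "induced_subgraph T G" unfolding T_def by (rule induced_induce)
  interpret T: digraph T using ind by (rule digraphI_induced)
  interpret T: sym_digraph T using ind by (rule induced_graph_imp_graph)
  have "graph T" by unfold_locales
  moreover have "card (verts T) = 3" using distinct by (simp add: T_def)
  moreover have "arcs_ends T = {(x, y). (x, y) \<in> verts T \<times> verts T \<and> x \<noteq> y}"
  proof -
    have "arcs_ends T = arcs_ends G \<inter> {u, v, w} \<times> {u, v, w}"
      by (auto simp: T_def arcs_ends_conv)
    then show ?thesis using adj distinct by (auto simp: T_def dest: adj_not_same)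
  qed
  ultimately have "K\<^bsub>3\<^esub> T" unfolding complete_digraph_def by blast
  moreover have "subgraph T G" using ind by (rule induced_imp_subgraph)
  ultimately show "in_common_triangle G u v"
    unfolding in_common_triangle_def T_def by auto
qed

lemma nbhd_induce_subgraph:
  "nbhd (G \<restriction> S) v = (if v \<in> S then nbhd G v \<inter> S else {})"
  by (auto simp: nbhd_def arcs_ends_conv)


section \<open>Interference by open neighbourhoods\<close>

text \<open>
  By cases on the adjacency of \<open>u\<close> and \<open>v\<close>. Quantified over \<open>v \<in> D\<close>, the right-hand side is
  the disjunctive form of the implication in condition (b).
\<close>

lemma (in graph) share_neighbour_iff:
  assumes "u \<in> verts G" "u \<noteq> v"
  shows "nbhd G u \<inter> nbhd G v \<noteq> {} \<longleftrightarrow>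
           v \<in> nbhd2 G u \<or> v \<in> nbhd G u \<and> in_common_triangle G u v"
  using assms by (auto simp: nbhd2_eq in_common_triangle_iff)

lemma (in graph) dist_le_2_if_share_neighbour:
  assumes "u \<in> verts G" "u \<noteq> v" "nbhd G u \<inter> nbhd G v \<noteq> {}"
  shows "graph_dist G u v \<le> 2"
proof (cases "v \<in> nbhd G u")
  case True
  then have "graph_dist G u v \<le> ereal (real 1)" unfolding graph_dist_le_1_iff by blast
  also have "\<dots> \<le> 2" by simp
  finally show ?thesis .
next
  case False
  then have "v \<in> nbhd2 G u" using assms by (simp add: nbhd2_eq)
  then show ?thesis by (simp add: nbhd2_def)
qed

theorem theorem4p3:
  fixes G :: "('a, 'b) pre_digraph" and D :: "'a set"
  assumes "graph G"
    and "D \<noteq> {}"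
    and "D \<subseteq> verts G"
  shows "(interference_complete (verts G) D (nbhd G) \<longleftrightarrow>
            point_determining G \<and>
            (\<nexists>v. isolated_vertex G v) \<and>
            (\<forall>u \<in> verts G - D.
               graph_dist_set G u D \<le> 2 \<and>
               (nbhd2 G u \<inter> D = {} \<longrightarrow>
                  (\<exists>v \<in> D \<inter> nbhd G u. in_common_triangle G u v))))
       \<and> (\<forall>u \<in> verts G - D.
            (\<exists>v \<in> D \<inter> nbhd G u. in_common_triangle G u v) \<longleftrightarrow>
            \<not> (\<forall>v \<in> D \<inter> nbhd G u. isolated_vertex (G \<restriction> nbhd G u) v))"
proof -
  interpret graph G by fact
  have "(\<exists>v \<in> D. nbhd G u \<inter> nbhd G v \<noteq> {}) \<longleftrightarrow>
          graph_dist_set G u D \<le> 2 \<and>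
          (nbhd2 G u \<inter> D = {} \<longrightarrow> (\<exists>v \<in> D \<inter> nbhd G u. in_common_triangle G u v))"
    if "u \<in> verts G - D" for u
  proof -
    have u: "u \<in> verts G" "\<And>v. v \<in> D \<Longrightarrow> u \<noteq> v" using that by auto
    have "(\<exists>v \<in> D. nbhd G u \<inter> nbhd G v \<noteq> {}) \<longleftrightarrow>
            (nbhd2 G u \<inter> D = {} \<longrightarrow> (\<exists>v \<in> D \<inter> nbhd G u. in_common_triangle G u v))"
      using share_neighbour_iff[OF u(1) u(2)] by blast
    moreover have "graph_dist_set G u D \<le> 2" if "\<exists>v \<in> D. nbhd G u \<inter> nbhd G v \<noteq> {}"
      using that dist_le_2_if_share_neighbour[OF u(1) u(2)]
      unfolding graph_dist_set_le_iff[OF assms(2,3)] by blast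
    ultimately show ?thesis by blast
  qed
  moreover have "(\<exists>v \<in> D \<inter> nbhd G u. in_common_triangle G u v) \<longleftrightarrow>
      \<not> (\<forall>v \<in> D \<inter> nbhd G u. isolated_vertex (G \<restriction> nbhd G u) v)" for u
  proof -
    have "in_common_triangle G u v \<longleftrightarrow> \<not> isolated_vertex (G \<restriction> nbhd G u) v"
      if "v \<in> nbhd G u" for v
    proof -
      have "u \<noteq> v" using that not_in_own_nbhd by blast
      then show ?thesis using that
        by (auto simp: in_common_triangle_iff isolated_vertex_def nbhd_induce_subgraph)
    qed
    then show ?thesis by blast
  qed
  moreover have no_isolated: "(\<nexists>v. isolated_vertex G v) \<longleftrightarrow> (\<forall>u \<in> verts G. nbhd G u \<noteq> {})"
    by (auto simp: isolated_vertex_def)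
  ultimately show ?thesis
    unfolding interference_complete_def point_determining_def no_isolated by simp
qed

end
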